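(* Assume that $\varphi$ satisfies the Hölderian error bound with parameter $\tau>0$ and that $\operatorname{int}(\operatorname{dom}\omega)\cap X'\neq\emptyset$. Let $\{\mathbf{x}^{k}\}$ be a sequence generated by the algorithm FBi-PG (defined in the context, with $t_k=(k+a)/a$ for $k\ge 0$ and an integer $a\ge 2$) with $1<\gamma<2$. Then for every $\mathbf{x}'\in\operatorname{int}(\operatorname{dom}\omega)\cap X'$ there is a subgradient $\xi\in\partial\omega(\mathbf{x}')$ such that, with $\rho=\|\xi\|$ and $$C=a^{2}\max\left\{\beta\|\mathbf{x}^{0}-\mathbf{x}'\|^{2}+\bigl(\omega(\mathbf{x}')-\omega^{\ast}\bigr),\; a^{3}\rho^{2}\tau^{-1}(\gamma-1)^{-2}\right\},$$ the following inequalities hold for all integers $k\ge1$: (i) $\varphi(\mathbf{x}^{k})-\varphi(\mathbf{x}')\le \dfrac{aC}{(k+1)^{2}}$; (ii) $\omega(\mathbf{x}')-\omega(\mathbf{x}^{k})\le \dfrac{C}{a^{2}(k+1)}$; (iii) $\omega(\mathbf{x}^{k})-\omega(\mathbf{x}')\le \dfrac{C}{(k+1)^{2-\gamma}}$.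
   Context: Bi-level problem: the inner problem is $\min_{\mathbf{x}\in\mathbb{R}^n}\{\varphi(\mathbf{x}):=f(\mathbf{x})+g(\mathbf{x})\}$ with solution set $X^{\ast}$; the outer problem is $\min_{\mathbf{x}\in X^{\ast}}\{\omega(\mathbf{x}):=\sigma(\mathbf{x})+\psi(\mathbf{x})\}$, and $X'\subset X^{\ast}$ is the set of its optimal solutions (minimizers of $\omega$ over $X^\ast$, at which $\omega$ is finite). Standing assumptions: (i) $f,\sigma:\mathbb{R}^n\to\mathbb{R}$ are convex and continuously differentiable with Lipschitz continuous gradients with constants $\beta_f,\beta_\sigma$, and $\beta:=\beta_f+\beta_\sigma>0$; (ii) $g,\psi:\mathbb{R}^n\to(-\infty,\infty]$ are proper, lower semicontinuous and convex; (iii) $X^{\ast}\ne\emptyset$; (iv) $\omega^{\ast}:=\inf_{\mathbf{x}\in\mathbb{R}^n}\omega(\mathbf{x})>-\infty$. Norms are Euclidean; $\partial\omega$ is the convex subdifferential. Hölderian error bound: a proper, lower semicontinuous, convex $h:\mathbb{R}^n\to(-\infty,+\infty]$ satisfies it with parameter $\tau>0$ if $\tau\cdot\operatorname{dist}(\mathbf{x},\operatorname{arg\,min}h)^2\le h(\mathbf{x})-\min_{\mathbf{z}\in\mathbb{R}^n}h(\mathbf{z})$ for all $\mathbf{x}\in\mathbb{R}^n$. Algorithm FBi-PG: input $\gamma>0$ and an integer $a\ge 2$. Set $\alpha_{-1}=t_{-1}=0$, $\mathbf{x}^{0}=\mathbf{x}^{-1}\in\mathbb{R}^n$ arbitrary,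 and for $k\ge0$ let $\alpha_k=(k+a)^{-\gamma}$, $t_k=(k+a)/a$, $f_k=f+\alpha_k\sigma$, $g_k=g+\alpha_k\psi$. For $k=0,1,2,\ldots$: $$\mathbf{y}^{k}=\mathbf{x}^{k}+t_k^{-1}(t_{k-1}-1)(\mathbf{x}^{k}-\mathbf{x}^{k-1}),\qquad \mathbf{x}^{k+1}=\operatorname*{arg\,min}_{\mathbf{x}\in\mathbb{R}^n}\Bigl\{g_k(\mathbf{x})+\mathbf{x}^{T}\nabla f_k(\mathbf{y}^{k})+\tfrac{\beta}{2}\|\mathbf{x}-\mathbf{y}^{k}\|^{2}\Bigr\}.$$ *)

theory Defs
  imports "HOL-Analysis.Analysis"
begin

definition edomain :: "('v \<Rightarrow> ereal) \<Rightarrow> 'v set" where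
  "edomain h = {x. h x < \<infinity>}"

definition proper :: "('v \<Rightarrow> ereal) \<Rightarrow> bool" where
  "proper h \<longleftrightarrow> (\<forall>x. h x \<noteq> -\<infinity>) \<and> edomain h \<noteq> {}"

definition lsc :: "('v::topological_space \<Rightarrow> ereal) \<Rightarrow> bool" where
  "lsc h \<longleftrightarrow> (\<forall>x. h x \<le> Liminf (at x) h)"

text \<open>Only used for functions that never take the value \<open>-\<infinity>\<close>.
  The convention \<open>0 * \<infinity> = 0\<close> of \<^typ>\<open>ereal\<close> makes the cases \<open>u = 0\<close> and \<open>u = 1\<close> trivial,
  as intended.\<close>

definition econvex :: "('v::real_vector \<Rightarrow> ereal) \<Rightarrow> bool" where
  "econvex h \<longleftrightarrow> (\<forall>x y. \<forall>u\<in>{0..1::real}.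
     h ((1 - u) *\<^sub>R x + u *\<^sub>R y) \<le> ereal (1 - u) * h x + ereal u * h y)"

definition subdifferential :: "('v::real_inner \<Rightarrow> ereal) \<Rightarrow> 'v \<Rightarrow> 'v set" where
  "subdifferential h x = {\<xi>. \<forall>z. h x + ereal (\<xi> \<bullet> (z - x)) \<le> h z}"

definition argmin :: "('v \<Rightarrow> ereal) \<Rightarrow> 'v set" where
  "argmin h = {x. \<forall>z. h x \<le> h z}"

text \<open>The first conjunct says that the minimum of \<^term>\<open>h\<close> exists; it is then \<open>INF z. h z\<close>.
  It is needed because \<^const>\<open>infdist\<close> to the empty set is \<open>0\<close>.\<close>

definition hoelder_error_bound :: "real \<Rightarrow> ('v::real_normed_vector \<Rightarrow> ereal) \<Rightarrow> bool" where
  "hoelder_error_bound \<tau> h \<longleftrightarrow> argmin h \<noteq> {} \<and>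
     (\<forall>x. ereal (\<tau> * (infdist x (argmin h))\<^sup>2) \<le> h x - (INF z. h z))"

definition gradient :: "('v::real_inner \<Rightarrow> real) \<Rightarrow> 'v \<Rightarrow> 'v" where
  "gradient h x = (THE D. GDERIV h x :> D)"

lemma gradient_eqI:
  assumes "GDERIV h x :> D"
  shows "gradient h x = D"
  unfolding gradient_def
proof (rule the_equality)
  fix E assume "GDERIV h x :> E"
  then have "(\<lambda>v. v \<bullet> E) = (\<lambda>v. v \<bullet> D)"
    using assms unfolding gderiv_def by (rule has_derivative_unique)
  then show "E = D"
    by (metis vector_eq_ldot)
qed (rule assms)

definition C1_lipschitz_gradient :: "real \<Rightarrow> ('v::real_inner \<Rightarrow> real) \<Rightarrow> bool" where
  "C1_lipschitz_gradient L h \<longleftrightarrow>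
     (\<forall>x. \<exists>D. GDERIV h x :> D) \<and> continuous_on UNIV (gradient h) \<and> L-lipschitz_on UNIV (gradient h)"

definition composite :: "('v \<Rightarrow> real) \<Rightarrow> ('v \<Rightarrow> ereal) \<Rightarrow> 'v \<Rightarrow> ereal" where
  "composite p q x = ereal (p x) + q x"

definition bilevel_solutions :: "('v \<Rightarrow> ereal) \<Rightarrow> ('v \<Rightarrow> ereal) \<Rightarrow> 'v set" where
  "bilevel_solutions \<phi> \<omega> = {x \<in> argmin \<phi>. \<omega> x < \<infinity> \<and> (\<forall>z\<in>argmin \<phi>. \<omega> x \<le> \<omega> z)}"

definition fbipg_alpha :: "nat \<Rightarrow> real \<Rightarrow> nat \<Rightarrow> real" where
  "fbipg_alpha a \<gamma> k = (real k + real a) powr (- \<gamma>)"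

definition fbipg_t :: "nat \<Rightarrow> nat \<Rightarrow> real" where
  "fbipg_t a k = (real k + real a) / real a"

text \<open>The predecessors \<open>t\<^bsub>k-1\<^esub>\<close> and \<open>x\<^bsub>k-1\<^esub>\<close>,
  with the initial values \<open>t\<^bsub>-1\<^esub> = 0\<close> and \<open>x\<^bsub>-1\<^esub> = x\<^bsub>0\<^esub>\<close>.\<close>

definition fbipg_t_prev :: "nat \<Rightarrow> nat \<Rightarrow> real" where
  "fbipg_t_prev a k = (case k of 0 \<Rightarrow> 0 | Suc j \<Rightarrow> fbipg_t a j)"

definition fbipg_x_prev :: "(nat \<Rightarrow> 'v) \<Rightarrow> nat \<Rightarrow> 'v" where
  "fbipg_x_prev x k = (case k of 0 \<Rightarrow> x 0 | Suc j \<Rightarrow> x j)"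

definition fbipg_y :: "nat \<Rightarrow> (nat \<Rightarrow> 'v::real_vector) \<Rightarrow> nat \<Rightarrow> 'v" where
  "fbipg_y a x k =
     x k + (inverse (fbipg_t a k) * (fbipg_t_prev a k - 1)) *\<^sub>R (x k - fbipg_x_prev x k)"

definition fbipg_smooth ::
  "('v \<Rightarrow> real) \<Rightarrow> ('v \<Rightarrow> real) \<Rightarrow> nat \<Rightarrow> real \<Rightarrow> nat \<Rightarrow> 'v \<Rightarrow> real" where
  "fbipg_smooth f \<sigma> a \<gamma> k z = f z + fbipg_alpha a \<gamma> k * \<sigma> z"

definition fbipg_nonsmooth ::
  "('v \<Rightarrow> ereal) \<Rightarrow> ('v \<Rightarrow> ereal) \<Rightarrow> nat \<Rightarrow> real \<Rightarrow> nat \<Rightarrow> 'v \<Rightarrow> ereal" where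
  "fbipg_nonsmooth g \<psi> a \<gamma> k z = g z + ereal (fbipg_alpha a \<gamma> k) * \<psi> z"

text \<open>The objective of each step is strongly convex, so membership in \<^const>\<open>argmin\<close>
  determines the next iterate whenever the objective is proper.\<close>

definition fbipg_sequence ::
  "('v::real_inner \<Rightarrow> real) \<Rightarrow> ('v \<Rightarrow> ereal) \<Rightarrow> ('v \<Rightarrow> real) \<Rightarrow> ('v \<Rightarrow> ereal) \<Rightarrow>
   real \<Rightarrow> nat \<Rightarrow> real \<Rightarrow> (nat \<Rightarrow> 'v) \<Rightarrow> bool" where
  "fbipg_sequence f g \<sigma> \<psi> \<beta> a \<gamma> x \<longleftrightarrow> (\<forall>k.
     x (Suc k) \<in> argmin (\<lambda>z. fbipg_nonsmooth g \<psi> a \<gamma> k z +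
       ereal (z \<bullet> gradient (fbipg_smooth f \<sigma> a \<gamma> k) (fbipg_y a x k)
              + \<beta> / 2 * (norm (z - fbipg_y a x k))\<^sup>2)))"

end

theory Submission
  imports Defs
begin

text \<open>
  Fix \<open>x'\<close> and write \<open>p\<^sub>k = \<phi> (x\<^sub>k) - \<phi> x'\<close>, \<open>q\<^sub>k = \<omega> (x\<^sub>k) - \<omega> x'\<close>, \<open>\<alpha>\<^sub>k\<close> and \<open>t\<^sub>k\<close> for the two
  parameter sequences of the algorithm, and \<open>M = C / a\<^sup>2\<close>.

  Each iteration is an accelerated proximal gradient step on \<open>\<phi> + \<alpha>\<^sub>k \<omega>\<close>. The usual analysis, which
  compares the new iterate with a convex combination of the old one and \<open>x'\<close>, therefore bounds
  \<open>E\<^sub>k = t\<^sub>k\<^sup>2 (p\<^sub>k\<^sub>+\<^sub>1 + \<alpha>\<^sub>k q\<^sub>k\<^sub>+\<^sub>1) + U\<^sub>k\<^sub>+\<^sub>1\<close> by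
  \<open>(t\<^sub>k\<^sup>2 - t\<^sub>k) (p\<^sub>k + \<alpha>\<^sub>k q\<^sub>k) + U\<^sub>k\<close>, where \<open>U\<^sub>k\<close> is a multiple of a squared distance (\<open>accelerated_step\<close>).
  For a fixed objective minimized at \<open>x'\<close> this would make \<open>E\<close> decreasing. Here \<open>\<alpha>\<^sub>k\<close> changes, and \<open>q\<^sub>k\<close> may be negative,
  since \<open>x'\<close> minimizes \<open>\<omega>\<close> over the solutions of the inner problem only. So \<open>E\<close> can
  grow, by at most a multiple of the negative part of \<open>q\<^sub>k\<close>.

  That negative part is small near the inner solutions. Since \<open>x'\<close> lies in the interior of the domain
  of \<open>\<omega>\<close>, its optimality is witnessed by a subgradient \<open>\<xi>\<close> of \<open>\<omega>\<close> with
  \<open>\<xi> \<bullet> (z - x') \<ge> 0\<close> for all inner solutions \<open>z\<close> (\<open>constrained_min_subgradient\<close>, a separation argument).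
  Hence \<open>- q\<^sub>k\<close> is at most \<open>norm \<xi>\<close> times the distance of \<open>x\<^sub>k\<close> to the inner solutions, and the
  error bound turns this into \<open>- q\<^sub>k \<le> r sqrt p\<^sub>k\<close> with \<open>r = norm \<xi> / sqrt \<tau>\<close>.

  The two estimates close up in an induction on \<open>k\<close>. As long as \<open>E\<^sub>k \<le> M\<close>, a quadratic inequality for
  \<open>t\<^sub>k sqrt (p\<^sub>k\<^sub>+\<^sub>1)\<close> gives \<open>sqrt (p\<^sub>k\<^sub>+\<^sub>1) \<le> sqrt (a M) / t\<^sub>k\<close> (\<open>scaled_value_le\<close>), so the
  growth in step \<open>k\<close> is at most \<open>M / a\<close> times \<open>(\<gamma> - 1) (k + a) powr - \<gamma>\<close>. This is dominated by a telescoping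
  difference of \<open>n powr (1 - \<gamma>)\<close> because \<open>\<gamma> > 1\<close>, and the total growth is at most
  \<open>M / a \<le> M / 2\<close>. As the energy starts below \<open>M / 2\<close>, it stays below \<open>M\<close> (\<open>energy_le\<close>). The three
  rates are read off from \<open>E\<^sub>k \<le> M\<close>.
\<close>

section \<open>Extended real convex functions on their domain\<close>

lemma edomain_convex:
  assumes "econvex h"
  shows "convex (edomain h)"
proof (rule convexI)
  fix x y and u v :: real
  assume x: "x \<in> edomain h" and y: "y \<in> edomain h" and u: "0 \<le> u" "0 \<le> v" "u + v = 1"
  then have "h ((1 - v) *\<^sub>R x + v *\<^sub>R y) \<le> ereal (1 - v) * h x + ereal v * h y"
    using assms unfolding econvex_def by auto
  also have "ereal (1 - v) * h x + ereal v * h y < \<infinity>"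
    using x y u unfolding edomain_def by (cases "h x"; cases "h y") auto
  finally have "h ((1 - v) *\<^sub>R x + v *\<^sub>R y) < \<infinity>" .
  moreover have "1 - v = u" using u by simp
  ultimately show "u *\<^sub>R x + v *\<^sub>R y \<in> edomain h"
    by (simp add: edomain_def)
qed

lemma edomain_ereal:
  assumes "proper h" "x \<in> edomain h"
  shows "ereal (real_of_ereal (h x)) = h x"
  using assms unfolding proper_def edomain_def by (cases "h x") auto

lemma real_convex_on_edomain:
  assumes "proper h" "econvex h"
  shows "convex_on (edomain h) (\<lambda>z. real_of_ereal (h z))"
proof (rule convex_onI)
  fix u x y
  assume u: "0 < (u::real)" "u < 1" and x: "x \<in> edomain h" and y: "y \<in> edomain h"
  have d: "(1 - u) *\<^sub>R x + u *\<^sub>R y \<in> edomain h"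
    using convexD[OF edomain_convex[OF assms(2)] x y, of "1 - u" u] u by simp
  have "h ((1 - u) *\<^sub>R x + u *\<^sub>R y) \<le> ereal (1 - u) * h x + ereal u * h y"
    using assms(2) u unfolding econvex_def by auto
  then have "ereal (real_of_ereal (h ((1 - u) *\<^sub>R x + u *\<^sub>R y)))
      \<le> ereal (1 - u) * ereal (real_of_ereal (h x)) + ereal u * ereal (real_of_ereal (h y))"
    by (simp only: edomain_ereal[OF assms(1)] d x y)
  then show "real_of_ereal (h ((1 - u) *\<^sub>R x + u *\<^sub>R y))
      \<le> (1 - u) * real_of_ereal (h x) + u * real_of_ereal (h y)"
    by simp
qed (rule edomain_convex[OF assms(2)])

section \<open>Smooth convex functions\<close>

lemma has_derivative_gradient:
  assumes "C1_lipschitz_gradient L h"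
  shows "(h has_derivative (\<lambda>v. v \<bullet> gradient h x)) (at x)"
proof -
  obtain D where D: "GDERIV h x :> D"
    using assms unfolding C1_lipschitz_gradient_def by blast
  then show ?thesis
    using gradient_eqI[OF D] unfolding gderiv_def by simp
qed

lemma DERIV_along_line:
  assumes "C1_lipschitz_gradient L h"
  shows "((\<lambda>s. h (x + s *\<^sub>R v)) has_real_derivative (v \<bullet> gradient h (x + s *\<^sub>R v))) (at s within S)"
proof -
  have "((\<lambda>s. h (x + s *\<^sub>R v)) has_derivative (\<lambda>r. (r *\<^sub>R v) \<bullet> gradient h (x + s *\<^sub>R v))) (at s within S)"
    by (rule has_derivative_compose[OF _ has_derivative_gradient[OF assms]])
      (auto intro!: derivative_eq_intros)
  then show ?thesis
    by (simp add: has_field_derivative_def mult_commute_abs)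
qed

text \<open>On the segment from \<open>x\<close> to \<open>z\<close> the gap between \<open>h\<close> and the quadratic upper model has a nonpositive
  derivative, because the gradient moves by at most \<open>L\<close> times the distance travelled.\<close>

lemma descent_lemma:
  assumes "C1_lipschitz_gradient L h"
  shows "h z \<le> h x + gradient h x \<bullet> (z - x) + L / 2 * (norm (z - x))\<^sup>2"
proof -
  define v where "v = z - x"
  have "L-lipschitz_on UNIV (gradient h)"
    using assms unfolding C1_lipschitz_gradient_def by blast
  then have lip: "norm (gradient h (x + s *\<^sub>R v) - gradient h x) \<le> L * (s * norm v)" if "s \<ge> 0" for s
    using lipschitz_onD[of L UNIV "gradient h" "x + s *\<^sub>R v" x] that by (simp add: dist_norm)
  have "h (x + 1 *\<^sub>R v) - 1 * (v \<bullet> gradient h x) - L / 2 * 1\<^sup>2 * (norm v)\<^sup>2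
      \<le> h (x + 0 *\<^sub>R v) - 0 * (v \<bullet> gradient h x) - L / 2 * 0\<^sup>2 * (norm v)\<^sup>2"
  proof (rule DERIV_nonpos_imp_nonincreasing[where a = 0 and b = "1::real"
        and f = "\<lambda>s. h (x + s *\<^sub>R v) - s * (v \<bullet> gradient h x) - L / 2 * s\<^sup>2 * (norm v)\<^sup>2"])
    fix s :: real assume s: "0 \<le> s" "s \<le> 1"
    have "v \<bullet> (gradient h (x + s *\<^sub>R v) - gradient h x)
        \<le> norm v * norm (gradient h (x + s *\<^sub>R v) - gradient h x)"
      by (rule norm_cauchy_schwarz)
    also have "\<dots> \<le> norm v * (L * (s * norm v))"
      by (intro mult_left_mono lip s) simp
    finally have "v \<bullet> gradient h (x + s *\<^sub>R v) - v \<bullet> gradient h x - L * s * (norm v)\<^sup>2 \<le> 0"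
      by (simp add: inner_diff_right power2_eq_square algebra_simps)
    moreover have "((\<lambda>s. h (x + s *\<^sub>R v) - s * (v \<bullet> gradient h x) - L / 2 * s\<^sup>2 * (norm v)\<^sup>2)
        has_real_derivative v \<bullet> gradient h (x + s *\<^sub>R v) - v \<bullet> gradient h x - L * s * (norm v)\<^sup>2) (at s)"
      by (auto intro!: derivative_eq_intros DERIV_along_line[OF assms])
    ultimately show "\<exists>y. ((\<lambda>s. h (x + s *\<^sub>R v) - s * (v \<bullet> gradient h x) - L / 2 * s\<^sup>2 * (norm v)\<^sup>2)
        has_real_derivative y) (at s) \<and> y \<le> 0"
      by blast
  qed simp
  then show ?thesis
    by (simp add: v_def inner_commute)
qed

lemma convex_above_tangent:
  assumes "C1_lipschitz_gradient L h" "convex_on UNIV h"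
  shows "h x + gradient h x \<bullet> (z - x) \<le> h z"
proof -
  define v where "v = z - x"
  have "convex_on UNIV (\<lambda>s::real. h (x + s *\<^sub>R v))"
  proof (rule convex_onI)
    fix t r s :: real assume "0 < t" "t < 1"
    then have "h ((1 - t) *\<^sub>R (x + r *\<^sub>R v) + t *\<^sub>R (x + s *\<^sub>R v))
        \<le> (1 - t) * h (x + r *\<^sub>R v) + t * h (x + s *\<^sub>R v)"
      by (intro convex_onD[OF assms(2)]) auto
    moreover have "(1 - t) *\<^sub>R (x + r *\<^sub>R v) + t *\<^sub>R (x + s *\<^sub>R v)
        = x + ((1 - t) *\<^sub>R r + t *\<^sub>R s) *\<^sub>R v"
      by (simp add: algebra_simps)
    ultimately show "h (x + ((1 - t) *\<^sub>R r + t *\<^sub>R s) *\<^sub>R v)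
        \<le> (1 - t) * h (x + r *\<^sub>R v) + t * h (x + s *\<^sub>R v)"
      by simp
  qed simp
  from convex_on_imp_above_tangent[OF this _ _ _ DERIV_along_line[OF assms(1)], of 0 1]
  show ?thesis
    by (simp add: v_def inner_commute)
qed

lemma C1_lipschitz_gradient_add_scaled:
  assumes f: "C1_lipschitz_gradient L f" and s: "C1_lipschitz_gradient K s"
    and c: "0 \<le> c" "c \<le> 1"
  shows "C1_lipschitz_gradient (L + K) (\<lambda>z. f z + c * s z)"
proof -
  have gd: "GDERIV (\<lambda>z. f z + c * s z) z :> gradient f z + c *\<^sub>R gradient s z" for z
    unfolding gderiv_def
    by (auto intro!: derivative_eq_intros has_derivative_gradient[OF f] has_derivative_gradient[OF s]
        simp: inner_add_right)
  have gr: "gradient (\<lambda>z. f z + c * s z) = (\<lambda>z. gradient f z + c *\<^sub>R gradient s z)"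
    using gradient_eqI[OF gd] by auto
  have lf: "L-lipschitz_on UNIV (gradient f)" and ls: "K-lipschitz_on UNIV (gradient s)"
    using f s unfolding C1_lipschitz_gradient_def by auto
  have "(L + K)-lipschitz_on UNIV (\<lambda>z. gradient f z + c *\<^sub>R gradient s z)"
  proof (rule lipschitz_on_add[OF lf])
    have "(\<bar>c\<bar> * K)-lipschitz_on UNIV (\<lambda>z. c *\<^sub>R gradient s z)"
      by (rule lipschitz_on_cmult[OF ls])
    then show "K-lipschitz_on UNIV (\<lambda>z. c *\<^sub>R gradient s z)"
      by (rule lipschitz_on_mono)
        (use c lipschitz_on_nonneg[OF ls] mult_left_le_one_le in auto)
  qed
  then show ?thesis
    unfolding C1_lipschitz_gradient_def gr
    using gd lipschitz_on_continuous_on by blast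
qed

section \<open>The accelerated proximal gradient step\<close>

text \<open>A proximal step adds a quadratic of modulus \<open>\<beta>\<close> to a convex function, so the objective grows at
  least like that quadratic away from its minimizer. This follows by comparing \<open>w\<close> with points on the segment to \<open>z\<close>
  that tend to \<open>w\<close>.\<close>

lemma prox_three_point:
  assumes h: "convex_on D h" and w: "w \<in> D" and z: "z \<in> D"
    and min: "\<And>v. v \<in> D \<Longrightarrow> h w + w \<bullet> G + \<beta> / 2 * (norm (w - y))\<^sup>2 \<le> h v + v \<bullet> G + \<beta> / 2 * (norm (v - y))\<^sup>2"
  shows "h w + w \<bullet> G + \<beta> / 2 * (norm (w - y))\<^sup>2 + \<beta> / 2 * (norm (z - w))\<^sup>2
    \<le> h z + z \<bullet> G + \<beta> / 2 * (norm (z - y))\<^sup>2"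
proof -
  define Q where "Q v = h v + v \<bullet> G + \<beta> / 2 * (norm (v - y))\<^sup>2" for v
  have "Q w + (1 - s) * (\<beta> / 2 * (norm (z - w))\<^sup>2) \<le> Q z" if s: "0 < s" "s < 1" for s
  proof -
    define v where "v = (1 - s) *\<^sub>R w + s *\<^sub>R z"
    have "v \<in> D"
      using convexD[OF convex_on_imp_convex[OF h] w z, of "1 - s" s] s by (simp add: v_def)
    then have "Q w \<le> Q v" using min unfolding Q_def by blast
    also have "Q v \<le> (1 - s) * Q w + s * Q z - s * ((1 - s) * (\<beta> / 2 * (norm (z - w))\<^sup>2))"
    proof -
      have "h v \<le> (1 - s) * h w + s * h z"
        unfolding v_def using s by (intro convex_onD[OF h _ _ w z]) auto
      moreover have "(norm (v - y))\<^sup>2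
          = (1 - s) * (norm (w - y))\<^sup>2 + s * (norm (z - y))\<^sup>2 - s * (1 - s) * (norm (z - w))\<^sup>2"
        unfolding v_def power2_norm_eq_inner
        by (simp add: inner_diff inner_add algebra_simps inner_commute)
      then have "\<beta> / 2 * (norm (v - y))\<^sup>2 = (1 - s) * (\<beta> / 2 * (norm (w - y))\<^sup>2)
          + s * (\<beta> / 2 * (norm (z - y))\<^sup>2) - s * ((1 - s) * (\<beta> / 2 * (norm (z - w))\<^sup>2))"
        by (simp only:) (simp add: field_simps)
      moreover have "v \<bullet> G = (1 - s) * (w \<bullet> G) + s * (z \<bullet> G)"
        by (simp add: v_def inner_add_left)
      ultimately show ?thesis
        unfolding Q_def distrib_left by linarith
    qed
    finally have "0 \<le> s * (Q z - Q w - (1 - s) * (\<beta> / 2 * (norm (z - w))\<^sup>2))"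
      by (simp add: algebra_simps)
    then show ?thesis
      using s by (simp add: zero_le_mult_iff)
  qed
  then have "\<forall>\<^sub>F s in at_right 0. Q w + (1 - s) * (\<beta> / 2 * (norm (z - w))\<^sup>2) \<le> Q z"
    unfolding eventually_at_right[OF zero_less_one] by (intro exI[of _ 1]) auto
  moreover have "((\<lambda>s. Q w + (1 - s) * (\<beta> / 2 * (norm (z - w))\<^sup>2)) \<longlongrightarrow>
      Q w + (1 - 0) * (\<beta> / 2 * (norm (z - w))\<^sup>2)) (at_right 0)"
    by (intro tendsto_intros)
  ultimately have "Q w + (1 - 0) * (\<beta> / 2 * (norm (z - w))\<^sup>2) \<le> Q z"
    by (intro tendsto_upperbound) auto
  then show ?thesis unfolding Q_def by simp
qed

text \<open>The descent lemma replaces the linearization of \<open>f\<close> at \<open>y\<close> by \<open>f w\<close> at the cost of the quadratic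
  term, and convexity replaces it by \<open>f z\<close>.\<close>

lemma prox_gradient_step:
  assumes f: "convex_on UNIV f" "C1_lipschitz_gradient \<beta> f"
    and G: "convex_on D G" and w: "w \<in> D" and z: "z \<in> D"
    and min: "\<And>v. v \<in> D \<Longrightarrow> G w + w \<bullet> gradient f y + \<beta> / 2 * (norm (w - y))\<^sup>2
       \<le> G v + v \<bullet> gradient f y + \<beta> / 2 * (norm (v - y))\<^sup>2"
  shows "f w + G w + \<beta> / 2 * (norm (w - z))\<^sup>2 \<le> f z + G z + \<beta> / 2 * (norm (y - z))\<^sup>2"
proof -
  have "f w \<le> f y + (w \<bullet> gradient f y - y \<bullet> gradient f y) + \<beta> / 2 * (norm (w - y))\<^sup>2"
    using descent_lemma[OF f(2), of w y]
    by (simp add: inner_diff_right inner_commute[of "gradient f y"])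
  moreover have "f y + (z \<bullet> gradient f y - y \<bullet> gradient f y) \<le> f z"
    using convex_above_tangent[OF f(2,1), of y z]
    by (simp add: inner_diff_right inner_commute[of "gradient f y"])
  moreover have "G w + w \<bullet> gradient f y + \<beta> / 2 * (norm (w - y))\<^sup>2 + \<beta> / 2 * (norm (z - w))\<^sup>2
      \<le> G z + z \<bullet> gradient f y + \<beta> / 2 * (norm (z - y))\<^sup>2"
    by (rule prox_three_point[OF G w z min])
  ultimately show ?thesis
    unfolding norm_minus_commute[of w z] norm_minus_commute[of y z] by argo
qed

text \<open>Compare the step with \<open>z = (1 - 1 / t) x + (1 / t) p\<close> and multiply by \<open>t\<^sup>2\<close>. When \<open>t = 1\<close> this point
  is \<open>p\<close> itself, so the old iterate may then lie outside the domain; this covers an arbitrary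
  starting point.\<close>

lemma accelerated_step:
  assumes f: "convex_on UNIV f" "C1_lipschitz_gradient \<beta> f"
    and G: "convex_on D G" and w: "w \<in> D" and p: "p \<in> D"
    and t: "t \<ge> 1" and x: "x \<in> D \<or> t = 1"
    and min: "\<And>v. v \<in> D \<Longrightarrow> G w + w \<bullet> gradient f y + \<beta> / 2 * (norm (w - y))\<^sup>2
       \<le> G v + v \<bullet> gradient f y + \<beta> / 2 * (norm (v - y))\<^sup>2"
  shows "t\<^sup>2 * (f w + G w - (f p + G p)) + \<beta> / 2 * (norm (t *\<^sub>R w - (t - 1) *\<^sub>R x - p))\<^sup>2
     \<le> (t\<^sup>2 - t) * (f x + G x - (f p + G p)) + \<beta> / 2 * (norm (t *\<^sub>R y - (t - 1) *\<^sub>R x - p))\<^sup>2"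
proof -
  define s where "s = 1 / t"
  define z where "z = (1 - s) *\<^sub>R x + s *\<^sub>R p"
  have s: "0 \<le> s" "s \<le> 1" "t * s = 1" using t by (auto simp: s_def)
  have z: "z \<in> D" and Fz: "f z + G z \<le> (1 - s) * (f x + G x) + s * (f p + G p)"
  proof -
    have "z \<in> D \<and> f z + G z \<le> (1 - s) * (f x + G x) + s * (f p + G p)"
    proof (cases "t = 1")
      case True
      then show ?thesis using p by (simp add: z_def s_def)
    next
      case False
      then have x: "x \<in> D" using x by simp
      have "f z \<le> (1 - s) * f x + s * f p" "G z \<le> (1 - s) * G x + s * G p"
        unfolding z_def using s by (auto intro!: convex_onD[OF f(1)] convex_onD[OF G _ _ x p])
      moreover have "z \<in> D"
        using convexD[OF convex_on_imp_convex[OF G] x p, of "1 - s" s] s by (simp add: z_def)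
      ultimately show ?thesis by (simp add: algebra_simps)
    qed
    then show "z \<in> D" "f z + G z \<le> (1 - s) * (f x + G x) + s * (f p + G p)" by auto
  qed
  have tz: "t *\<^sub>R z = (t - 1) *\<^sub>R x + p"
    using s(3) by (simp add: z_def scaleR_add_right right_diff_distrib)
  have n: "(norm (t *\<^sub>R v - (t - 1) *\<^sub>R x - p))\<^sup>2 = t\<^sup>2 * (norm (v - z))\<^sup>2" for v
  proof -
    have "t *\<^sub>R v - (t - 1) *\<^sub>R x - p = t *\<^sub>R (v - z)"
      using tz by (simp add: scaleR_diff_right)
    then show ?thesis by (simp add: power_mult_distrib)
  qed
  have "f w + G w + \<beta> / 2 * (norm (w - z))\<^sup>2 \<le> f z + G z + \<beta> / 2 * (norm (y - z))\<^sup>2"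
    by (rule prox_gradient_step[OF f G w z min])
  then have "f w + G w + \<beta> / 2 * (norm (w - z))\<^sup>2
      \<le> (1 - s) * (f x + G x) + s * (f p + G p) + \<beta> / 2 * (norm (y - z))\<^sup>2"
    using Fz by linarith
  then have "t\<^sup>2 * (f w + G w + \<beta> / 2 * (norm (w - z))\<^sup>2)
      \<le> t\<^sup>2 * ((1 - s) * (f x + G x) + s * (f p + G p) + \<beta> / 2 * (norm (y - z))\<^sup>2)"
    by (rule mult_left_mono) simp
  moreover have "t\<^sup>2 * s = t" using s(3) by (simp add: power2_eq_square)
  then have "t\<^sup>2 * ((1 - s) * (f x + G x) + s * (f p + G p))
      = (t\<^sup>2 - t) * (f x + G x) + t * (f p + G p)"
    by (simp add: distrib_left right_diff_distrib mult.assoc[symmetric])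
  ultimately show ?thesis
    unfolding n by (simp add: algebra_simps)
qed

section \<open>Subgradients at constrained minimizers\<close>

text \<open>Minimality means that \<open>X \<times> {..0}\<close> does not meet the strict epigraph of \<open>W - W p\<close>, so a
  hyperplane separates the two convex sets. It is not vertical because \<open>p\<close> is interior to \<open>S\<close>;
  its slope is the required subgradient.\<close>

lemma constrained_min_subgradient:
  fixes W :: "'v::euclidean_space \<Rightarrow> real"
  assumes W: "convex_on S W" and X: "convex X" and p: "p \<in> interior S" "p \<in> X"
    and min: "\<And>z. z \<in> X \<Longrightarrow> z \<in> S \<Longrightarrow> W p \<le> W z"
  obtains \<xi> where "\<And>z. z \<in> S \<Longrightarrow> W p + \<xi> \<bullet> (z - p) \<le> W z" "\<And>z. z \<in> X \<Longrightarrow> 0 \<le> \<xi> \<bullet> (z - p)"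
proof -
  have pS: "p \<in> S" using p interior_subset by blast
  define A where "A = {(z, r). z \<in> S \<and> W z - W p < r}"
  define B where "B = X \<times> {..0::real}"
  have cS: "convex S" using convex_on_imp_convex[OF W] .
  have "convex A"
  proof (rule convexI)
    fix v w and s t :: real assume "v \<in> A" "w \<in> A" and st: "0 \<le> s" "0 \<le> t" "s + t = 1"
    then obtain y q z r where v: "v = (y, q)" "y \<in> S" "W y - W p < q"
      and w: "w = (z, r)" "z \<in> S" "W z - W p < r"
      unfolding A_def by blast
    have s: "s = 1 - t" using st by simp
    have "W (s *\<^sub>R y + t *\<^sub>R z) \<le> s * W y + t * W z"
      unfolding s using st by (intro convex_onD[OF W _ _ v(2) w(2)]) auto
    moreover have "s * (W y - W p) + t * (W z - W p) < s * q + t * r"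
    proof (cases "t = 0")
      case False
      then have "t * (W z - W p) < t * r" using st w by simp
      moreover have "s * (W y - W p) \<le> s * q" using st v by (intro mult_left_mono) auto
      ultimately show ?thesis by linarith
    qed (use s v in simp)
    moreover have "s * (W y - W p) + t * (W z - W p) = s * W y + t * W z - W p"
      unfolding s by (simp add: algebra_simps)
    ultimately show "s *\<^sub>R v + t *\<^sub>R w \<in> A"
      using convexD[OF cS v(2) w(2) st] by (simp add: A_def v w)
  qed
  moreover have "convex B" unfolding B_def by (intro convex_Times X) simp
  moreover have "A \<noteq> {}" "B \<noteq> {}"
  proof -
    have "(p, 1) \<in> A" "(p, 0) \<in> B" using pS p by (auto simp: A_def B_def)
    then show "A \<noteq> {}" "B \<noteq> {}" by blast+
  qed
  moreover have "B \<inter> A = {}" using min by (fastforce simp: A_def B_def)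
  ultimately obtain n b where n: "n \<noteq> 0" "\<forall>v\<in>B. n \<bullet> v \<le> b" "\<forall>v\<in>A. b \<le> n \<bullet> v"
    using separating_hyperplane_sets[of B A] by metis
  obtain u c where uc: "n = (u, c)" by force
  have An: "b \<le> u \<bullet> z + c * r" if "z \<in> S" "W z - W p < r" for z r
    using n(3) that by (auto simp: A_def uc)
  have Bn: "u \<bullet> z \<le> b" if "z \<in> X" for z
    using n(2) that by (force simp: B_def uc)
  have b: "b \<le> u \<bullet> p"
  proof (rule tendsto_lowerbound)
    show "((\<lambda>r. u \<bullet> p + c * r) \<longlongrightarrow> u \<bullet> p) (at_right 0)"
      by (auto intro!: tendsto_eq_intros)
    show "\<forall>\<^sub>F r in at_right 0. b \<le> u \<bullet> p + c * r"
      using eventually_at_right_less[of "0::real"] by eventually_elim (use An[OF pS] in simp)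
  qed simp
  then have b: "b = u \<bullet> p" using Bn[OF p(2)] by simp
  have "0 \<le> c" using An[OF pS, of 1] b by simp
  (* A vertical hyperplane would support S at p, but an interior point can be moved against u. *)
  have "c \<noteq> 0"
  proof
    assume c: "c = 0"
    then have u0: "u \<noteq> 0" using n(1) uc by (simp add: zero_prod_def)
    obtain e where e: "e > 0" "ball p e \<subseteq> S" using p(1) mem_interior by blast
    define z where "z = p - (e / 2 / norm u) *\<^sub>R u"
    have "z \<in> S" using e u0 by (intro subsetD[OF e(2)]) (simp add: z_def dist_norm)
    then have "b \<le> u \<bullet> z" using An[of z "W z - W p + 1"] c by simp
    then have "e / 2 / norm u * (u \<bullet> u) \<le> 0" using b by (simp add: z_def inner_diff_right)
    moreover have "0 < e / 2 / norm u * (u \<bullet> u)" using e u0 by simp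
    ultimately show False by linarith
  qed
  with \<open>0 \<le> c\<close> have c: "c > 0" by simp
  have le: "u \<bullet> p \<le> u \<bullet> z + c * (W z - W p)" if "z \<in> S" for z
  proof (rule tendsto_lowerbound)
    show "((\<lambda>r. u \<bullet> z + c * r) \<longlongrightarrow> u \<bullet> z + c * (W z - W p)) (at_right (W z - W p))"
      by (auto intro!: tendsto_eq_intros)
    show "\<forall>\<^sub>F r in at_right (W z - W p). u \<bullet> p \<le> u \<bullet> z + c * r"
      using eventually_at_right_less[of "W z - W p"]
      by eventually_elim (use An[OF that] b in simp)
  qed simp
  show ?thesis
  proof
    fix z assume "z \<in> S"
    from le[OF this] have "(u \<bullet> p - u \<bullet> z) / c \<le> W z - W p"
      using c by (simp add: divide_le_eq mult.commute)
    then show "W p + (- (1 / c) *\<^sub>R u) \<bullet> (z - p) \<le> W z"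
      using c by (simp add: inner_diff_right diff_divide_distrib)
  next
    fix z assume "z \<in> X"
    from Bn[OF this] show "0 \<le> (- (1 / c) *\<^sub>R u) \<bullet> (z - p)"
      using c b by (simp add: inner_diff_right divide_right_mono)
  qed
qed

text \<open>Move from \<open>x\<close> to a point of \<open>X\<close>, where the linear function is nonnegative; taking the infimum over
  such points avoids a projection, so \<open>X\<close> may be any nonempty set.\<close>

lemma subgradient_dist_bound:
  assumes "\<And>z. z \<in> X \<Longrightarrow> 0 \<le> \<xi> \<bullet> (z - p)" "X \<noteq> {}"
  shows "- (\<xi> \<bullet> (x - p)) \<le> norm \<xi> * infdist x X"
proof (cases "\<xi> = 0")
  case False
  have "- (\<xi> \<bullet> (x - p)) / norm \<xi> \<le> infdist x X"
    unfolding infdist_notempty[OF assms(2)]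
  proof (rule cINF_greatest[OF assms(2)])
    fix z assume "z \<in> X"
    have "- (\<xi> \<bullet> (x - p)) \<le> \<xi> \<bullet> (z - x)"
      using assms(1)[OF \<open>z \<in> X\<close>] by (simp add: inner_diff_right)
    also have "\<dots> \<le> norm \<xi> * dist x z"
      using norm_cauchy_schwarz[of \<xi> "z - x"] by (simp add: dist_norm norm_minus_commute)
    finally show "- (\<xi> \<bullet> (x - p)) / norm \<xi> \<le> dist x z"
      using False by (simp add: divide_le_eq mult.commute del: minus_divide_left divide_minus_left)
  qed
  then show ?thesis
    using False by (simp add: divide_le_eq mult.commute del: minus_divide_left divide_minus_left)
qed simp

section \<open>Growth of the energy\<close>

text \<open>Sums of \<open>n powr - \<gamma>\<close> are thus at most of order \<open>1 / (\<gamma> - 1)\<close>. The growth of the energy is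
  \<open>r * sqrt (a * M)\<close> times such a sum, so keeping it below \<open>M\<close> asks for \<open>r\<^sup>2\<close> to be at most of order
  \<open>M * (\<gamma> - 1)\<^sup>2\<close>. This is the origin of the factor \<open>(\<gamma> - 1)\<^sup>2\<close> in the constant.\<close>

lemma powr_telescope:
  fixes n \<gamma> :: real
  assumes "n > 1" "\<gamma> > 1"
  shows "(\<gamma> - 1) * n powr - \<gamma> \<le> (n - 1) powr (1 - \<gamma>) - n powr (1 - \<gamma>)"
proof -
  have "\<exists>z>n - 1. z < n \<and> n powr (1 - \<gamma>) - (n - 1) powr (1 - \<gamma>)
      = (n - (n - 1)) * ((1 - \<gamma>) * z powr (1 - \<gamma> - 1))"
    by (rule MVT2) (use assms in \<open>auto intro!: derivative_eq_intros\<close>)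
  then obtain z where z: "n - 1 < z" "z < n"
    "n powr (1 - \<gamma>) - (n - 1) powr (1 - \<gamma>) = (1 - \<gamma>) * z powr - \<gamma>"
    by auto
  have "n powr - \<gamma> \<le> z powr - \<gamma>"
    using z assms by (intro powr_mono2') auto
  then have "(\<gamma> - 1) * n powr - \<gamma> \<le> (\<gamma> - 1) * z powr - \<gamma>"
    using assms by (intro mult_left_mono) auto
  then show ?thesis using z by (simp add: algebra_simps)
qed

text \<open>All that the rates need to know about the iterates. In the application \<open>p\<close> and \<open>q\<close> are the inner and
  outer objective gaps relative to the fixed bilevel solution, \<open>U\<close> is the squared-distance term, and
  \<open>r\<close> combines the norm of the subgradient with the error bound. The values \<open>p 0\<close> and \<open>q 0\<close> are
  arbitrary because \<open>fbipg_t a 0 = 1\<close> gives them weight zero.\<close>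

locale fbipg_energy =
  fixes a :: nat and \<gamma> M r :: real and p q U :: "nat \<Rightarrow> real"
  assumes a: "a \<ge> 2" and \<gamma>: "1 < \<gamma>" "\<gamma> < 2" and M: "M \<ge> 0" and r: "r \<ge> 0"
    and M_ge: "real a ^ 3 * r\<^sup>2 \<le> M * (\<gamma> - 1)\<^sup>2"
    and U_nonneg: "\<And>k. U k \<ge> 0" and U_init: "U 0 \<le> M / 2"
    and p_nonneg: "\<And>k. p (Suc k) \<ge> 0"
    and q_lower: "\<And>k. - q (Suc k) \<le> r * sqrt (p (Suc k))"
    and step: "\<And>k. (fbipg_t a k)\<^sup>2 * (p (Suc k) + fbipg_alpha a \<gamma> k * q (Suc k)) + U (Suc k)
      \<le> ((fbipg_t a k)\<^sup>2 - fbipg_t a k) * (p k + fbipg_alpha a \<gamma> k * q k) + U k"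
begin

definition energy :: "nat \<Rightarrow> real" where
  "energy k = (fbipg_t a k)\<^sup>2 * (p (Suc k) + fbipg_alpha a \<gamma> k * q (Suc k)) + U (Suc k)"

lemma a_real: "real a \<ge> 2" using a by simp

lemma t_ge_1: "fbipg_t a k \<ge> 1"
  using a_real by (simp add: fbipg_t_def)

lemma r_sqrt_le: "r * sqrt (real a * M) \<le> M * (\<gamma> - 1) / real a"
proof (rule power2_le_imp_le)
  have "(real a * r)\<^sup>2 * real a * M \<le> M * (\<gamma> - 1)\<^sup>2 * M"
    using mult_right_mono[OF M_ge M] by (simp add: power2_eq_square power3_eq_cube mult_ac)
  then show "(r * sqrt (real a * M))\<^sup>2 \<le> (M * (\<gamma> - 1) / real a)\<^sup>2"
    using a_real M by (simp add: power_mult_distrib power_divide le_divide_eq power2_eq_square mult_ac)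
  show "0 \<le> M * (\<gamma> - 1) / real a" using M \<gamma> by simp
qed

text \<open>With \<open>P = t sqrt p\<close>, the energy bound and the lower bound on \<open>q\<close> give a quadratic inequality
  \<open>P\<^sup>2 \<le> M + c P\<close>, in which \<open>c = t \<alpha> r\<close> is small compared with \<open>sqrt M\<close>. This even yields
  \<open>P\<^sup>2 \<le> 2 M\<close>.\<close>

lemma scaled_value_le:
  assumes "energy k \<le> M"
  shows "fbipg_t a k * sqrt (p (Suc k)) \<le> sqrt (real a * M)"
proof -
  define t \<alpha> P where "t = fbipg_t a k" and "\<alpha> = fbipg_alpha a \<gamma> k" and "P = t * sqrt (p (Suc k))"
  define c where "c = t * \<alpha> * r"
  define n where "n = real k + real a"
  have n: "n \<ge> 2" using a_real by (simp add: n_def)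
  have t: "t \<ge> 1" using t_ge_1 by (simp add: t_def)
  have \<alpha>: "\<alpha> \<ge> 0" by (simp add: \<alpha>_def fbipg_alpha_def)
  have P2: "P\<^sup>2 = t\<^sup>2 * p (Suc k)"
    using p_nonneg by (simp add: P_def power_mult_distrib)
  have "t\<^sup>2 * \<alpha> * (- q (Suc k)) \<le> t\<^sup>2 * \<alpha> * (r * sqrt (p (Suc k)))"
    using \<alpha> by (intro mult_left_mono q_lower) auto
  then have "P\<^sup>2 \<le> M + c * P"
    using assms U_nonneg[of "Suc k"] unfolding energy_def P2 t_def[symmetric] \<alpha>_def[symmetric]
    by (simp add: c_def P_def power2_eq_square algebra_simps)
  moreover have "c * P \<le> c\<^sup>2 + P\<^sup>2 / 4"
    using zero_le_power2[of "c - P / 2"] by (simp add: power2_diff power_divide)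
  moreover have "c\<^sup>2 \<le> M / 8"
  proof -
    have "t * \<alpha> = n powr (1 - \<gamma>) / real a"
      using n by (simp add: t_def \<alpha>_def fbipg_t_def fbipg_alpha_def n_def[symmetric] powr_diff powr_minus
          divide_inverse)
    moreover have "n powr (1 - \<gamma>) \<le> 1"
      using powr_mono[of "1 - \<gamma>" 0 n] n \<gamma> by simp
    ultimately have "t * \<alpha> \<le> 1"
      using a_real by (simp add: divide_le_eq)
    then have "c \<le> r" "0 \<le> c"
      using mult_right_mono[of "t * \<alpha>" 1 r] r t \<alpha> by (auto simp: c_def)
    then have "c\<^sup>2 \<le> r\<^sup>2" by (intro power_mono)
    moreover have "(2::real) ^ 3 \<le> real a ^ 3"
      using a_real by (intro power_mono) auto
    then have "8 * r\<^sup>2 \<le> real a ^ 3 * r\<^sup>2"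
      by (intro mult_right_mono) auto
    moreover have "M * (\<gamma> - 1)\<^sup>2 \<le> M * 1"
      using M \<gamma> by (intro mult_left_mono power_le_one) auto
    ultimately show ?thesis using M_ge by linarith
  qed
  moreover have "2 * M \<le> real a * M"
    using a_real M by (intro mult_right_mono) auto
  ultimately have "P\<^sup>2 \<le> real a * M" using M by linarith
  then show ?thesis
    unfolding P_def t_def by (rule real_le_rsqrt)
qed

lemma sqrt_value_le:
  assumes "energy k \<le> M"
  shows "sqrt (p (Suc k)) \<le> sqrt (real a * M) * real a / (real k + real a)"
  using scaled_value_le[OF assms] a_real
  by (simp add: fbipg_t_def field_simps)

text \<open>Passing from \<open>energy k\<close> to the right-hand side of the next step changes the weight of \<open>p\<close> by
  a nonpositive amount, as \<open>a \<ge> 2\<close>, and lowers the weight of \<open>q\<close> by \<open>s \<ge> 0\<close>. Only a negative \<open>q\<close>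
  can then increase the energy. As \<open>s\<close> is of order \<open>n powr (1 - \<gamma>)\<close> and \<open>sqrt p\<close> of order \<open>1 / n\<close>,
  the increase is of order \<open>n powr - \<gamma>\<close>.\<close>

lemma energy_increment:
  assumes "energy k \<le> M"
  shows "energy (Suc k) \<le> energy k
    + M / real a * ((real k + real a - 1) powr (1 - \<gamma>) - (real k + real a) powr (1 - \<gamma>))"
proof -
  define n where "n = real k + real a"
  define T where "T = (fbipg_t a (Suc k))\<^sup>2 - fbipg_t a (Suc k)"
  define s where "s = (fbipg_t a k)\<^sup>2 * fbipg_alpha a \<gamma> k - T * fbipg_alpha a \<gamma> (Suc k)"
  have n: "n \<ge> 2" using a_real by (simp add: n_def)
  have tk: "fbipg_t a k = n / real a" "fbipg_t a (Suc k) = (n + 1) / real a"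
    and \<alpha>k: "fbipg_alpha a \<gamma> k = n powr - \<gamma>" "fbipg_alpha a \<gamma> (Suc k) = (n + 1) powr - \<gamma>"
    by (simp_all add: fbipg_t_def fbipg_alpha_def n_def add_ac)
  have T0: "T \<ge> 0"
    using mult_right_mono[OF t_ge_1[of "Suc k"], of "fbipg_t a (Suc k)"] t_ge_1[of "Suc k"]
    by (simp add: T_def power2_eq_square)
  have "(fbipg_t a k)\<^sup>2 - T = (1 + (real a - 2) * (n + 1)) / (real a)\<^sup>2"
    using a_real by (simp add: T_def tk field_simps power2_eq_square)
  then have T_le: "T \<le> (fbipg_t a k)\<^sup>2"
    using a_real n by (smt (verit) divide_nonneg_nonneg mult_nonneg_nonneg zero_le_power2)
  have s0: "s \<ge> 0"
    using mult_mono[OF T_le, of "(n + 1) powr - \<gamma>" "n powr - \<gamma>"] n \<gamma>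
    by (simp add: s_def \<alpha>k powr_mono2')
  have s_le: "s \<le> n powr (1 - \<gamma>) / real a"
  proof -
    have e: "x\<^sup>2 * x powr - \<gamma> = x powr (2 - \<gamma>)" "x * x powr - \<gamma> = x powr (1 - \<gamma>)" if "x > 0" for x :: real
      using that by (simp_all add: powr_diff powr_minus divide_inverse)
    have "s = (n\<^sup>2 * n powr - \<gamma> - (n + 1)\<^sup>2 * (n + 1) powr - \<gamma>) / (real a)\<^sup>2
        + (n + 1) * (n + 1) powr - \<gamma> / real a"
      by (simp add: s_def T_def tk \<alpha>k power_divide diff_divide_distrib left_diff_distrib)
    also have "\<dots> = (n powr (2 - \<gamma>) - (n + 1) powr (2 - \<gamma>)) / (real a)\<^sup>2 + (n + 1) powr (1 - \<gamma>) / real a"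
      using n by (simp add: e)
    also have "\<dots> \<le> 0 + n powr (1 - \<gamma>) / real a"
      using n \<gamma> by (intro add_mono divide_right_mono powr_mono2' divide_nonpos_nonneg)
        (auto intro: powr_mono2)
    finally show ?thesis by simp
  qed
  have "energy (Suc k) \<le> T * (p (Suc k) + fbipg_alpha a \<gamma> (Suc k) * q (Suc k)) + U (Suc k)"
    using step[of "Suc k"] by (simp add: energy_def T_def)
  also have "\<dots> = energy k - ((fbipg_t a k)\<^sup>2 - T) * p (Suc k) + s * (- q (Suc k))"
    by (simp add: energy_def s_def algebra_simps)
  also have "\<dots> \<le> energy k + n powr (1 - \<gamma>) / real a * (r * (sqrt (real a * M) * real a / n))"
  proof -
    have "0 \<le> ((fbipg_t a k)\<^sup>2 - T) * p (Suc k)"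
      using T_le p_nonneg by simp
    moreover have "s * (- q (Suc k)) \<le> s * (r * sqrt (p (Suc k)))"
      using s0 by (intro mult_left_mono q_lower)
    moreover have "\<dots> \<le> n powr (1 - \<gamma>) / real a * (r * (sqrt (real a * M) * real a / n))"
      using s_le s0 r p_nonneg sqrt_value_le[OF assms]
      by (intro mult_mono) (auto simp: n_def)
    ultimately show ?thesis by linarith
  qed
  also have "n powr (1 - \<gamma>) / real a * (r * (sqrt (real a * M) * real a / n))
      = r * sqrt (real a * M) * n powr - \<gamma>"
    using n a_real by (simp add: powr_diff powr_minus field_simps)
  also have "\<dots> \<le> M * (\<gamma> - 1) / real a * n powr - \<gamma>"
    by (intro mult_right_mono r_sqrt_le) simp
  also have "\<dots> = M / real a * ((\<gamma> - 1) * n powr - \<gamma>)"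
    by simp
  also have "\<dots> \<le> M / real a * ((n - 1) powr (1 - \<gamma>) - n powr (1 - \<gamma>))"
    using M a_real n \<gamma> by (intro mult_left_mono powr_telescope) auto
  finally show ?thesis by (simp add: n_def)
qed

text \<open>The increments telescope to \<open>w\<close>, which is at most \<open>M / 2\<close>. The bound \<open>energy k \<le> M\<close> that justifies
  each increment is itself part of the induction.\<close>

lemma energy_le: "energy k \<le> M"
proof -
  define w where "w k = M / real a * ((real a - 1) powr (1 - \<gamma>) - (real k + real a - 1) powr (1 - \<gamma>))" for k
  have w: "w k \<le> M / 2" for k
  proof -
    have "(real a - 1) powr (1 - \<gamma>) \<le> 1"
      using powr_mono[of "1 - \<gamma>" 0 "real a - 1"] a_real \<gamma> by simp
    then have "w k \<le> M / real a * 1"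
      unfolding w_def using M a_real by (intro mult_left_mono) (auto simp: add_increasing2 algebra_simps)
    also have "\<dots> \<le> M / 2" using divide_left_mono[OF a_real M] a_real by simp
    finally show ?thesis .
  qed
  have "energy k \<le> M / 2 + w k"
  proof (induction k)
    case 0
    have "fbipg_t a 0 = 1" using a_real by (simp add: fbipg_t_def)
    then have "energy 0 \<le> U 0" using step[of 0] by (simp add: energy_def)
    then show ?case using U_init by (simp add: w_def)
  next
    case (Suc k)
    then have "energy k \<le> M" using w[of k] by simp
    from energy_increment[OF this] Suc show ?case
      by (simp add: w_def algebra_simps)
  qed
  then show ?thesis using w[of k] by simp
qed

theorem energy_rates:
  assumes "k \<ge> 1"
  shows "p k \<le> real a * ((real a)\<^sup>2 * M) / (real k + 1)\<^sup>2"
    and "- q k \<le> M / (real k + 1)"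
    and "q k \<le> (real a)\<^sup>2 * M / (real k + 1) powr (2 - \<gamma>)"
proof -
  obtain j where k: "k = Suc j" using assms by (cases k) auto
  define n where "n = real j + real a"
  (* The shift from j to k costs one unit, and a >= 2 makes up for it. *)
  have n: "n \<ge> real k + 1" using a_real by (simp add: n_def k)
  have n0: "n > 0" using n by simp
  have s: "sqrt (p k) \<le> sqrt (real a * M) * real a / n"
    using sqrt_value_le[OF energy_le[of j]] by (simp add: k n_def)
  have "p k = (sqrt (p k))\<^sup>2" using p_nonneg by (simp add: k)
  also have "\<dots> \<le> (sqrt (real a * M) * real a / n)\<^sup>2"
    using s p_nonneg by (intro power_mono) (auto simp: k)
  also have "\<dots> = real a * ((real a)\<^sup>2 * M) / n\<^sup>2"
    using M by (simp add: power_mult_distrib power_divide)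
  also have "\<dots> \<le> real a * ((real a)\<^sup>2 * M) / (real k + 1)\<^sup>2"
    using n M by (intro divide_left_mono power_mono mult_pos_pos mult_nonneg_nonneg) auto
  finally show "p k \<le> real a * ((real a)\<^sup>2 * M) / (real k + 1)\<^sup>2" .
  have "- q k \<le> r * sqrt (p k)" using q_lower by (simp add: k)
  also have "\<dots> \<le> r * (sqrt (real a * M) * real a / n)"
    using s r by (rule mult_left_mono)
  also have "\<dots> = r * sqrt (real a * M) * (real a / n)" by simp
  also have "\<dots> \<le> M * (\<gamma> - 1) / real a * (real a / n)"
    using n0 by (intro mult_right_mono r_sqrt_le) simp
  also have "\<dots> = M * (\<gamma> - 1) / n" using a_real by simp
  also have "\<dots> \<le> M * 1 / (real k + 1)"
    using M \<gamma> n by (intro frac_le mult_left_mono) auto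
  finally show "- q k \<le> M / (real k + 1)" by simp
  have "n powr (2 - \<gamma>) / (real a)\<^sup>2 * q k \<le> M"
  proof -
    have "(fbipg_t a j)\<^sup>2 * fbipg_alpha a \<gamma> j = n powr (2 - \<gamma>) / (real a)\<^sup>2"
      using n0 by (simp add: fbipg_t_def fbipg_alpha_def n_def[symmetric] power_divide powr_diff powr_minus_divide)
    moreover have "0 \<le> (fbipg_t a j)\<^sup>2 * p k" using p_nonneg by (simp add: k)
    ultimately show ?thesis
      using energy_le[of j] U_nonneg[of k] by (simp add: energy_def k distrib_left mult.assoc[symmetric])
  qed
  then have "q k \<le> (real a)\<^sup>2 * M / n powr (2 - \<gamma>)"
    using n0 a_real by (simp add: field_simps)
  also have "\<dots> \<le> (real a)\<^sup>2 * M / (real k + 1) powr (2 - \<gamma>)"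
    using n M \<gamma> by (intro divide_left_mono powr_mono2 mult_nonneg_nonneg mult_pos_pos) auto
  finally show "q k \<le> (real a)\<^sup>2 * M / (real k + 1) powr (2 - \<gamma>)" .
qed

end

section \<open>Convergence rates of the algorithm\<close>

lemma edomain_composite: "edomain (composite p h) = edomain h"
proof -
  have "composite p h z < \<infinity> \<longleftrightarrow> h z < \<infinity>" for z
    by (cases "h z") (auto simp: composite_def)
  then show ?thesis by (simp add: edomain_def)
qed

lemma composite_ereal:
  assumes "proper h" "z \<in> edomain h"
  shows "composite p h z = ereal (p z + real_of_ereal (h z))"
  using assms unfolding proper_def edomain_def composite_def by (cases "h z") auto

lemma argmin_composite_convex:
  assumes "convex_on UNIV p" "proper h" "econvex h"
  shows "argmin (composite p h) \<subseteq> edomain h" "convex (argmin (composite p h))"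
proof -
  let ?F = "\<lambda>z. p z + real_of_ereal (h z)"
  obtain c where c: "c \<in> edomain h" using assms(2) unfolding proper_def by blast
  show sub: "argmin (composite p h) \<subseteq> edomain h"
  proof
    fix z assume "z \<in> argmin (composite p h)"
    then have "composite p h z \<le> composite p h c" by (simp add: argmin_def)
    also have "composite p h c < \<infinity>"
      using c edomain_composite[of p h] by (auto simp: edomain_def)
    finally show "z \<in> edomain h"
      unfolding edomain_composite[of p h, symmetric] by (simp add: edomain_def)
  qed
  have F: "convex_on (edomain h) ?F"
    by (rule convex_on_add[OF convex_on_subset[OF assms(1)] real_convex_on_edomain[OF assms(2,3)]])
      (simp_all add: edomain_convex assms(3))
  show "convex (argmin (composite p h))"
  proof (rule convexI)
    fix x y and u v :: real
    assume x: "x \<in> argmin (composite p h)" and y: "y \<in> argmin (composite p h)"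
      and u: "0 \<le> u" "0 \<le> v" "u + v = 1"
    have xy: "x \<in> edomain h" "y \<in> edomain h" using x y sub by auto
    let ?w = "u *\<^sub>R x + v *\<^sub>R y"
    have w: "?w \<in> edomain h"
      using convexD[OF edomain_convex[OF assms(3)] xy u] .
    have eq: "composite p h x = composite p h y"
      using x y unfolding argmin_def by (intro antisym) simp_all
    then have "?F x = ?F y"
      using xy by (simp add: composite_ereal[OF assms(2)])
    moreover have "?F ?w \<le> u * ?F x + v * ?F y"
    proof -
      have "u = 1 - v" using u by simp
      then show ?thesis using convex_onD[OF F _ _ xy, of v] u(1,2) by simp
    qed
    moreover have "u * ?F x + v * ?F x = ?F x"
      unfolding distrib_right[symmetric] u(3) by simp
    ultimately have "?F ?w \<le> ?F x" by simp
    then have "composite p h ?w \<le> composite p h x"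
      using xy w by (simp add: composite_ereal[OF assms(2)])
    then show "?w \<in> argmin (composite p h)"
      using x order_trans unfolding argmin_def by blast
  qed
qed

theorem theorem4:
  fixes f \<sigma> :: "real ^ 'n \<Rightarrow> real"
    and g \<psi> \<phi> \<omega> :: "real ^ 'n \<Rightarrow> ereal"
    and \<beta>f \<beta>\<sigma> \<beta> \<tau> \<gamma> :: real
    and \<omega>star :: ereal
    and a :: nat
    and x :: "nat \<Rightarrow> real ^ 'n"
  assumes phi_def: "\<phi> = composite f g"
    and omega_def: "\<omega> = composite \<sigma> \<psi>"
    and f_convex: "convex_on UNIV f"
    and sigma_convex: "convex_on UNIV \<sigma>"
    and f_smooth: "C1_lipschitz_gradient \<beta>f f"
    and sigma_smooth: "C1_lipschitz_gradient \<beta>\<sigma> \<sigma>"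
    and beta_def: "\<beta> = \<beta>f + \<beta>\<sigma>"
    and beta_pos: "\<beta> > 0"
    and g_nice: "proper g" "lsc g" "econvex g"
    and psi_nice: "proper \<psi>" "lsc \<psi>" "econvex \<psi>"
    and Xstar_nonempty: "argmin \<phi> \<noteq> {}"
    and omegastar_def: "\<omega>star = (INF z. \<omega> z)"
    and omegastar_bound: "\<omega>star > -\<infinity>"
    and tau_pos: "\<tau> > 0"
    and error_bound: "hoelder_error_bound \<tau> \<phi>"
    and interior_point: "interior (edomain \<omega>) \<inter> bilevel_solutions \<phi> \<omega> \<noteq> {}"
    and a_ge: "a \<ge> 2"
    and gamma_range: "1 < \<gamma>" "\<gamma> < 2"
    and x_seq: "fbipg_sequence f g \<sigma> \<psi> \<beta> a \<gamma> x"
  shows "\<forall>x' \<in> interior (edomain \<omega>) \<inter> bilevel_solutions \<phi> \<omega>.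
    \<exists>\<xi> \<in> subdifferential \<omega> x'.
      let \<rho> = norm \<xi>;
          C = (real a)\<^sup>2 * max (\<beta> * (norm (x 0 - x'))\<^sup>2 + real_of_ereal (\<omega> x' - \<omega>star))
                             ((real a) ^ 3 * \<rho>\<^sup>2 * inverse \<tau> * inverse ((\<gamma> - 1)\<^sup>2))
      in \<forall>k\<ge>1.
           \<phi> (x k) - \<phi> x' \<le> ereal (real a * C / (real k + 1)\<^sup>2) \<and>
           \<omega> x' - \<omega> (x k) \<le> ereal (C / ((real a)\<^sup>2 * (real k + 1))) \<and>
           \<omega> (x k) - \<omega> x' \<le> ereal (C / (real k + 1) powr (2 - \<gamma>))"
proof
  fix x' assume x'_in: "x' \<in> interior (edomain \<omega>) \<inter> bilevel_solutions \<phi> \<omega>"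
  define X where "X = argmin \<phi>"
  define D where "D = edomain g \<inter> edomain \<psi>"
  define G where "G z = real_of_ereal (g z)" for z
  define S where "S z = real_of_ereal (\<psi> z)" for z
  have dom_\<omega>: "edomain \<omega> = edomain \<psi>"
    unfolding omega_def by (rule edomain_composite)
  have x'X: "x' \<in> X" and x'int: "x' \<in> interior (edomain \<psi>)"
    using x'_in unfolding bilevel_solutions_def X_def dom_\<omega> by blast+
  then have x'\<psi>: "x' \<in> edomain \<psi>" using interior_subset by blast
  have x'opt: "\<omega> x' \<le> \<omega> z" if "z \<in> X" for z
    using x'_in that unfolding bilevel_solutions_def X_def by blast
  have XG: "X \<subseteq> edomain g" and convX: "convex X"
    unfolding X_def phi_def using argmin_composite_convex[OF f_convex g_nice(1,3)] by blast+
  have \<phi>_eq: "\<phi> z = ereal (f z + G z)" if "z \<in> edomain g" for z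
    unfolding phi_def G_def by (rule composite_ereal[OF g_nice(1) that])
  have \<omega>_eq: "\<omega> z = ereal (\<sigma> z + S z)" if "z \<in> edomain \<psi>" for z
    unfolding omega_def S_def by (rule composite_ereal[OF psi_nice(1) that])
  have x'D: "x' \<in> D" using x'X x'\<psi> XG by (auto simp: D_def)
  have convD: "convex D"
    unfolding D_def by (intro convex_Int edomain_convex g_nice psi_nice)
  have convG: "convex_on (edomain g) G" and convS: "convex_on (edomain \<psi>) S"
    unfolding G_def S_def by (intro real_convex_on_edomain g_nice psi_nice)+
  have convW: "convex_on (edomain \<psi>) (\<lambda>z. \<sigma> z + S z)"
    by (rule convex_on_add[OF convex_on_subset[OF sigma_convex] convS])
      (simp_all add: edomain_convex psi_nice)
  obtain \<xi> where \<xi>: "\<And>z. z \<in> edomain \<psi> \<Longrightarrow> \<sigma> x' + S x' + \<xi> \<bullet> (z - x') \<le> \<sigma> z + S z"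
    and \<xi>X: "\<And>z. z \<in> X \<Longrightarrow> 0 \<le> \<xi> \<bullet> (z - x')"
  proof (rule constrained_min_subgradient[OF convW convX x'int x'X])
    fix z assume "z \<in> X" "z \<in> edomain \<psi>"
    then show "\<sigma> x' + S x' \<le> \<sigma> z + S z"
      using x'opt[of z] by (simp add: \<omega>_eq x'\<psi>)
  qed blast
  have \<xi>_sub: "\<xi> \<in> subdifferential \<omega> x'"
    unfolding subdifferential_def
  proof (intro CollectI allI)
    fix z show "\<omega> x' + ereal (\<xi> \<bullet> (z - x')) \<le> \<omega> z"
    proof (cases "z \<in> edomain \<psi>")
      case True
      then show ?thesis using \<xi>[OF True] by (simp add: \<omega>_eq x'\<psi>)
    next
      case False
      then have "z \<notin> edomain \<omega>" by (simp add: dom_\<omega>)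
      then have "\<omega> z = \<infinity>" by (simp add: edomain_def)
      then show ?thesis by simp
    qed
  qed
  (* The constant is C = a^2 * M. The first entry of M is at least twice the initial distance term U 0
     because the gap \<Delta> of the outer objective is nonnegative. *)
  define \<Delta> where "\<Delta> = real_of_ereal (\<omega> x' - \<omega>star)"
  define M where "M = max (\<beta> * (norm (x 0 - x'))\<^sup>2 + \<Delta>)
    ((real a) ^ 3 * (norm \<xi>)\<^sup>2 * inverse \<tau> * inverse ((\<gamma> - 1)\<^sup>2))"
  have \<Delta>: "\<Delta> \<ge> 0"
  proof -
    have "\<omega>star \<le> \<omega> x'" unfolding omegastar_def by (rule INF_lower) simp
    then show ?thesis
      unfolding \<Delta>_def using omegastar_bound by (cases \<omega>star) (auto simp: \<omega>_eq[OF x'\<psi>])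
  qed
  define r where "r = norm \<xi> / sqrt \<tau>"
  define p where "p k = f (x k) + G (x k) - (f x' + G x')" for k
  define q where "q k = \<sigma> (x k) + S (x k) - (\<sigma> x' + S x')" for k
  define U where "U k = \<beta> / 2 * (norm (fbipg_t_prev a k *\<^sub>R x k
      - (fbipg_t_prev a k - 1) *\<^sub>R fbipg_x_prev x k - x'))\<^sup>2" for k
  have \<alpha>: "0 < fbipg_alpha a \<gamma> k" "fbipg_alpha a \<gamma> k \<le> 1" for k
    using powr_mono[of "- \<gamma>" 0 "real k + real a"] a_ge gamma_range by (auto simp: fbipg_alpha_def)
  (* As \<alpha> is positive, an infinite value of \<psi> is not absorbed, and the objective of a step is finite
     exactly on D; comparison with x' shows that the iterates stay in D. *)
  have step_obj: "fbipg_nonsmooth g \<psi> a \<gamma> k z + ereal c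
      = (if z \<in> D then ereal (G z + fbipg_alpha a \<gamma> k * S z + c) else \<infinity>)" for k z c
  proof -
    have "g z \<noteq> -\<infinity>" "\<psi> z \<noteq> -\<infinity>" using g_nice psi_nice unfolding proper_def by auto
    then show ?thesis
      using \<alpha>(1)[of k] unfolding fbipg_nonsmooth_def D_def edomain_def G_def S_def
      by (cases "g z"; cases "\<psi> z") auto
  qed
  define y where "y = fbipg_y a x"
  define N where "N k = gradient (fbipg_smooth f \<sigma> a \<gamma> k) (y k)" for k
  have iter_le: "fbipg_nonsmooth g \<psi> a \<gamma> k (x (Suc k))
        + ereal (x (Suc k) \<bullet> N k + \<beta> / 2 * (norm (x (Suc k) - y k))\<^sup>2)
      \<le> fbipg_nonsmooth g \<psi> a \<gamma> k v + ereal (v \<bullet> N k + \<beta> / 2 * (norm (v - y k))\<^sup>2)" for k v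
    using x_seq unfolding fbipg_sequence_def argmin_def y_def N_def by blast
  have xD: "x (Suc k) \<in> D" for k
    using iter_le[of k x'] x'D unfolding step_obj by (simp split: if_splits)
  have iter_min: "G (x (Suc k)) + fbipg_alpha a \<gamma> k * S (x (Suc k)) + x (Suc k) \<bullet> N k
        + \<beta> / 2 * (norm (x (Suc k) - y k))\<^sup>2
      \<le> G v + fbipg_alpha a \<gamma> k * S v + v \<bullet> N k + \<beta> / 2 * (norm (v - y k))\<^sup>2" if "v \<in> D" for k v
    using iter_le[of k v] that xD[of k] unfolding step_obj by (simp add: add.assoc)
  have xD': "x k \<in> D" if "k \<ge> 1" for k
    using xD[of "k - 1"] that by simp
  have p_dist: "\<tau> * (infdist (x k) X)\<^sup>2 \<le> p k" if "k \<ge> 1" for k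
  proof -
    have "(INF z. \<phi> z) = \<phi> x'"
      using x'X unfolding X_def argmin_def by (intro antisym INF_lower INF_greatest) auto
    moreover have "ereal (\<tau> * (infdist (x k) X)\<^sup>2) \<le> \<phi> (x k) - (INF z. \<phi> z)"
      using error_bound unfolding hoelder_error_bound_def X_def by blast
    ultimately show ?thesis
      using xD'[OF that] x'D by (simp add: D_def \<phi>_eq p_def)
  qed
  have "fbipg_energy a \<gamma> M r p q U"
  proof
    show "2 \<le> a" "1 < \<gamma>" "\<gamma> < 2" by fact+
    show "0 \<le> M" unfolding M_def using \<Delta> beta_pos by (simp add: le_max_iff_disj)
    show "0 \<le> r" using tau_pos by (simp add: r_def)
    have r2: "r\<^sup>2 = (norm \<xi>)\<^sup>2 * inverse \<tau>"
      using tau_pos by (simp add: r_def power_divide divide_inverse[symmetric])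
    have "real a ^ 3 * r\<^sup>2 = (real a ^ 3 * (norm \<xi>)\<^sup>2 * inverse \<tau> * inverse ((\<gamma> - 1)\<^sup>2)) * (\<gamma> - 1)\<^sup>2"
      using r2 gamma_range by simp
    also have "\<dots> \<le> M * (\<gamma> - 1)\<^sup>2"
      unfolding M_def by (intro mult_right_mono) auto
    finally show "real a ^ 3 * r\<^sup>2 \<le> M * (\<gamma> - 1)\<^sup>2" .
    show "0 \<le> U k" for k using beta_pos by (simp add: U_def)
    have "U 0 = \<beta> * (norm (x 0 - x'))\<^sup>2 / 2"
      by (simp add: U_def fbipg_t_prev_def fbipg_x_prev_def)
    then show "U 0 \<le> M / 2" unfolding M_def using \<Delta> by simp
    show p_nonneg: "0 \<le> p (Suc k)" for k
      using p_dist[of "Suc k"] tau_pos by (smt (verit) One_nat_def Suc_leI mult_nonneg_nonneg zero_le_power2 zero_less_Suc)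
    show "- q (Suc k) \<le> r * sqrt (p (Suc k))" for k
    proof -
      have "- q (Suc k) \<le> - (\<xi> \<bullet> (x (Suc k) - x'))"
        using \<xi>[of "x (Suc k)"] xD[of k] by (simp add: q_def D_def)
      also have "\<dots> \<le> norm \<xi> * infdist (x (Suc k)) X"
        using x'X by (intro subgradient_dist_bound \<xi>X) auto
      also have "\<dots> \<le> norm \<xi> * sqrt (p (Suc k) / \<tau>)"
        using p_dist[of "Suc k"] tau_pos
        by (intro mult_left_mono real_le_rsqrt) (auto simp: le_divide_eq mult.commute)
      finally show ?thesis by (simp add: r_def real_sqrt_divide)
    qed
  next
    fix k
    define t where "t = fbipg_t a k"
    define \<alpha>k where "\<alpha>k = fbipg_alpha a \<gamma> k"
    have t: "t \<ge> 1" "t = 1 \<or> k \<ge> 1"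
      using a_ge by (auto simp: t_def fbipg_t_def)
    have sm: "fbipg_smooth f \<sigma> a \<gamma> k = (\<lambda>z. f z + \<alpha>k * \<sigma> z)"
      by (auto simp: fbipg_smooth_def \<alpha>k_def)
    have \<alpha>k: "0 \<le> \<alpha>k" "\<alpha>k \<le> 1" using \<alpha>[of k] by (auto simp: \<alpha>k_def)
    have "t\<^sup>2 * (f (x (Suc k)) + \<alpha>k * \<sigma> (x (Suc k)) + (G (x (Suc k)) + \<alpha>k * S (x (Suc k)))
          - (f x' + \<alpha>k * \<sigma> x' + (G x' + \<alpha>k * S x')))
        + \<beta> / 2 * (norm (t *\<^sub>R x (Suc k) - (t - 1) *\<^sub>R x k - x'))\<^sup>2
      \<le> (t\<^sup>2 - t) * (f (x k) + \<alpha>k * \<sigma> (x k) + (G (x k) + \<alpha>k * S (x k))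
          - (f x' + \<alpha>k * \<sigma> x' + (G x' + \<alpha>k * S x')))
        + \<beta> / 2 * (norm (t *\<^sub>R y k - (t - 1) *\<^sub>R x k - x'))\<^sup>2"
    proof (rule accelerated_step[where D = D])
      show "convex_on UNIV (\<lambda>z. f z + \<alpha>k * \<sigma> z)"
        by (intro convex_on_add convex_on_cmul f_convex sigma_convex \<alpha>k)
      show "C1_lipschitz_gradient \<beta> (\<lambda>z. f z + \<alpha>k * \<sigma> z)"
        unfolding beta_def by (intro C1_lipschitz_gradient_add_scaled f_smooth sigma_smooth \<alpha>k)
      show "convex_on D (\<lambda>z. G z + \<alpha>k * S z)"
        by (intro convex_on_add convex_on_cmul \<alpha>k convex_on_subset[OF convG] convex_on_subset[OF convS] convD)
          (auto simp: D_def)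
      show "x (Suc k) \<in> D" "x' \<in> D" "1 \<le> t" by (fact xD x'D t)+
      show "x k \<in> D \<or> t = 1" using t xD' by blast
      show "G (x (Suc k)) + \<alpha>k * S (x (Suc k)) + x (Suc k) \<bullet> gradient (\<lambda>z. f z + \<alpha>k * \<sigma> z) (y k)
          + \<beta> / 2 * (norm (x (Suc k) - y k))\<^sup>2
        \<le> G v + \<alpha>k * S v + v \<bullet> gradient (\<lambda>z. f z + \<alpha>k * \<sigma> z) (y k) + \<beta> / 2 * (norm (v - y k))\<^sup>2"
        if "v \<in> D" for v
        using iter_min[OF that, of k] unfolding N_def sm \<alpha>k_def[symmetric] .
    qed
    moreover have "f z + \<alpha>k * \<sigma> z + (G z + \<alpha>k * S z) - (f x' + \<alpha>k * \<sigma> x' + (G x' + \<alpha>k * S x'))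
        = f z + G z - (f x' + G x') + \<alpha>k * (\<sigma> z + S z - (\<sigma> x' + S x'))" for z
      by (simp add: algebra_simps)
    (* The extrapolation weights are chosen so that the distance term of this step is the one
       left over by the previous step. *)
    moreover have "t *\<^sub>R y k - (t - 1) *\<^sub>R x k
        = fbipg_t_prev a k *\<^sub>R x k - (fbipg_t_prev a k - 1) *\<^sub>R fbipg_x_prev x k"
    proof -
      have "t *\<^sub>R y k = t *\<^sub>R x k + (fbipg_t_prev a k - 1) *\<^sub>R (x k - fbipg_x_prev x k)"
        using t unfolding y_def fbipg_y_def t_def[symmetric] by (simp add: scaleR_add_right)
      then show ?thesis by (simp add: algebra_simps)
    qed
    moreover have "U (Suc k) = \<beta> / 2 * (norm (t *\<^sub>R x (Suc k) - (t - 1) *\<^sub>R x k - x'))\<^sup>2"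
      by (simp add: U_def fbipg_t_prev_def fbipg_x_prev_def t_def)
    ultimately show "(fbipg_t a k)\<^sup>2 * (p (Suc k) + fbipg_alpha a \<gamma> k * q (Suc k)) + U (Suc k)
      \<le> ((fbipg_t a k)\<^sup>2 - fbipg_t a k) * (p k + fbipg_alpha a \<gamma> k * q k) + U k"
      unfolding t_def[symmetric] \<alpha>k_def[symmetric] p_def q_def U_def[of k] by simp
  qed
  then interpret fbipg_energy a \<gamma> M r p q U .
  have "\<phi> (x k) - \<phi> x' \<le> ereal (real a * ((real a)\<^sup>2 * M) / (real k + 1)\<^sup>2) \<and>
      \<omega> x' - \<omega> (x k) \<le> ereal ((real a)\<^sup>2 * M / ((real a)\<^sup>2 * (real k + 1))) \<and>
      \<omega> (x k) - \<omega> x' \<le> ereal ((real a)\<^sup>2 * M / (real k + 1) powr (2 - \<gamma>))" if k: "k \<ge> 1" for k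
  proof -
    have "\<phi> (x k) - \<phi> x' = ereal (p k)" "\<omega> x' - \<omega> (x k) = ereal (- q k)"
      "\<omega> (x k) - \<omega> x' = ereal (q k)"
      using xD'[OF k] x'D by (simp_all add: D_def \<phi>_eq \<omega>_eq p_def q_def)
    moreover have "(real a)\<^sup>2 * M / ((real a)\<^sup>2 * (real k + 1)) = M / (real k + 1)"
      using a_ge by simp
    ultimately show ?thesis
      using energy_rates[OF k] by simp
  qed
  then show "\<exists>\<xi> \<in> subdifferential \<omega> x'.
      let \<rho> = norm \<xi>;
          C = (real a)\<^sup>2 * max (\<beta> * (norm (x 0 - x'))\<^sup>2 + real_of_ereal (\<omega> x' - \<omega>star))
                             ((real a) ^ 3 * \<rho>\<^sup>2 * inverse \<tau> * inverse ((\<gamma> - 1)\<^sup>2))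
      in \<forall>k\<ge>1.
           \<phi> (x k) - \<phi> x' \<le> ereal (real a * C / (real k + 1)\<^sup>2) \<and>
           \<omega> x' - \<omega> (x k) \<le> ereal (C / ((real a)\<^sup>2 * (real k + 1))) \<and>
           \<omega> (x k) - \<omega> x' \<le> ereal (C / (real k + 1) powr (2 - \<gamma>))"
    using \<xi>_sub unfolding Let_def M_def \<Delta>_def by blast
qed

end
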